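(* Let $H\le\mathbb{T}$ be a countable subgroup and let $(\varepsilon_j)_{j\ge 0}$ be a sequence of real numbers with $0\le\varepsilon_j\le 1$ that converges to $0$ (arbitrarily slowly). Let $\mathbb{N}=\{0,1,2,\ldots\}$ be partitioned into nonempty intervals $I_j=\{i_j,i_j+1,\ldots,i_{j+1}-1\}$, $j\ge 0$, with $i_0=0$ and $\lim_{j\to\infty}(i_{j+1}-i_j)=\infty$. Then there exists a sequence $(k_n)_{n=1}^\infty$ of nonnegative integers characterizing $H$ such that $$\frac{|\{n: k_n\in I_j\}|}{|I_j|}\ge\varepsilon_j\quad\text{for all } j.$$
   Context: $\mathbb{T}=\mathbb{R}/\mathbb{Z}$, written additively. Subgroups of $\mathbb{T}$ need not be closed. A sequence $(k_n)_{n=1}^\infty$ of integers characterizes the subgroup $H\le\mathbb{T}$ if for all $\alpha\in\mathbb{T}$: $\alpha\in H\iff\lim_{n\to\infty}k_n\alpha=0$ in $\mathbb{T}$. *)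

theory Defs
  imports Complex_Main "HOL-Library.Disjoint_Sets" "HOL-Library.Countable_Set"
begin

text \<open>The group \<open>\<real>/\<int>\<close> with the quotient topology.\<close>

quotient_type circle = real / "\<lambda>x y :: real. x - y \<in> \<int>"
  morphisms rep_circle to_circle
proof (rule equivpI)
  show "reflp (\<lambda>x y :: real. x - y \<in> \<int>)"
    by (auto intro: reflpI)
  show "symp (\<lambda>x y :: real. x - y \<in> \<int>)"
    by (rule sympI) (metis Ints_minus minus_diff_eq)
  show "transp (\<lambda>x y :: real. x - y \<in> \<int>)"
  proof (rule transpI)
    fix x y z :: real
    assume "x - y \<in> \<int>" "y - z \<in> \<int>"
    then have "(x - y) + (y - z) \<in> \<int>" by (rule Ints_add)
    then show "x - z \<in> \<int>" by simp
  qed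
qed

instantiation circle :: ab_group_add
begin

lift_definition zero_circle :: circle is 0 .

lift_definition plus_circle :: "circle \<Rightarrow> circle \<Rightarrow> circle" is "(+)"
  by (metis Ints_add add_diff_add)

lift_definition uminus_circle :: "circle \<Rightarrow> circle" is uminus
  by (metis Ints_minus minus_diff_minus)

lift_definition minus_circle :: "circle \<Rightarrow> circle \<Rightarrow> circle" is "(-)"
  by (metis Ints_diff diff_diff_eq2 diff_diff_add add_diff_eq add.commute diff_add_eq)

instance
  by standard (transfer; simp)+

end

instantiation circle :: topological_space
begin

definition open_circle :: "circle set \<Rightarrow> bool"
  where "open U \<longleftrightarrow> open (to_circle -` U)"

instance
  by standard (auto simp: open_circle_def vimage_Union)

end

lift_definition int_multiple :: "int \<Rightarrow> circle \<Rightarrow> circle" is "\<lambda>k x. of_int k * x"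
  by (metis Ints_mult Ints_of_int right_diff_distrib)

definition is_subgroup :: "circle set \<Rightarrow> bool"
  where "is_subgroup H \<longleftrightarrow>
    0 \<in> H \<and> (\<forall>x\<in>H. \<forall>y\<in>H. x + y \<in> H) \<and> (\<forall>x\<in>H. - x \<in> H)"

definition characterizes :: "(nat \<Rightarrow> int) \<Rightarrow> circle set \<Rightarrow> bool"
  where "characterizes k H \<longleftrightarrow>
    (\<forall>\<alpha>. \<alpha> \<in> H \<longleftrightarrow> (\<lambda>n. int_multiple (k n) \<alpha>) \<longlonglongrightarrow> 0)"

end

theory Submission
  imports Defs "HOL-Analysis.Complex_Transcendental" "HOL-Real_Asymp.Real_Asymp"
begin

text \<open>Identify the circle with the complex numbers of modulus 1, so that \<open>H\<close> becomes a
  multiplicative group \<open>G = {g\<^sub>0, g\<^sub>1, \<dots>}\<close>. Let \<open>B\<^sub>r\<close> be the Bohr set of the \<open>k\<close> for which all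
  \<open>g\<^sub>0 ^ k, \<dots>, g\<^sub>r ^ k\<close> are within \<open>1 / (r + 1)\<close> of 1. A product \<open>P\<close> of kernels \<open>(\<bar>1 + g\<^sub>i ^ k\<bar> / 2) ^ (2 * M)\<close>
  is a trigonometric polynomial in \<open>k\<close> with nonnegative coefficients and frequencies in \<open>G\<close>. Its mean
  is at least \<open>(1 / (2 * M)) ^ (r + 1)\<close>, whereas off \<open>B\<^sub>r\<close> it is exponentially small in \<open>M\<close>.
  Averaging \<open>P\<close> over a long interval shows that \<open>B\<^sub>r\<close> has positive density there; averaging
  \<open>P k * z ^ k\<close> shows that if \<open>z ^ k\<close> is within 1 of 1 for all \<open>k\<close> of \<open>B\<^sub>r\<close> in the interval, then \<open>z\<close> is
  close to a finite subset \<open>W\<^sub>r\<close> of \<open>G\<close>, where \<open>W\<^sub>r\<close> does not depend on how close.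

  The sequence enumerates a set that follows \<open>B\<^sub>r\<close> on a very long stage number \<open>r\<close>. If \<open>z ^ k\<close> tends
  to 1 along it, then \<open>z\<close> is close to some \<open>u\<^sub>r \<in> W\<^sub>r\<close> for all large \<open>r\<close>, and as the closeness at stage
  \<open>r\<close> beats the separation of \<open>W\<^sub>r\<close> and \<open>W\<^sub>r\<^sub>+\<^sub>1\<close>, all these \<open>u\<^sub>r\<close> coincide with \<open>z\<close>.\<close>

section \<open>Elementary estimates on the unit circle\<close>

text \<open>Closed form of the geometric series. Neither \<open>a\<close> nor \<open>L\<close>
  enters the bound, which makes the later averages uniform in the position of the interval.\<close>

lemma norm_geometric_sum_le:
  fixes w :: complex
  assumes "norm w = 1" "w \<noteq> 1"
  shows "norm (\<Sum>k\<in>{a..<a+L}. w ^ k) \<le> 2 / norm (w - 1)"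
proof -
  have "(\<Sum>k\<in>{a..<a+L}. w ^ k) = w ^ a * (\<Sum>k<L. w ^ k)"
    by (induction L) (simp_all add: power_add distrib_left)
  also have "(\<Sum>k<L. w ^ k) = (1 - w ^ L) / (1 - w)"
    using assms by (simp add: sum_gp_strict)
  finally have "norm (\<Sum>k\<in>{a..<a+L}. w ^ k) = norm (1 - w ^ L) / norm (w - 1)"
    using assms by (simp add: norm_mult norm_power norm_divide norm_minus_commute)
  moreover have "norm (1 - w ^ L) \<le> 2"
    using norm_triangle_ineq4[of 1 "w ^ L"] assms by (simp add: norm_power)
  ultimately show ?thesis
    by (simp add: divide_right_mono)
qed

text \<open>The parallelogram law for 1 and \<open>w\<close>. It converts distance of
  \<open>w\<close> from 1 into smallness of the kernel.\<close>

lemma norm_1_plus_power2: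
  fixes w :: complex
  assumes "norm w = 1"
  shows "(norm (1 + w))\<^sup>2 = 4 - (norm (w - 1))\<^sup>2"
proof -
  have "(Re w)\<^sup>2 + (Im w)\<^sup>2 = 1"
    using assms by (metis cmod_power2 one_power2)
  then show ?thesis
    by (simp add: cmod_power2) (simp add: power2_eq_square algebra_simps)
qed

text \<open>Supplies the exponent \<open>M\<close> of the kernels: \<open>q ^ M\<close> will bound
  their product off the Bohr set, and the power of \<open>1 / (2 * real M)\<close> bounds its mean
  from below.\<close>

lemma exponential_beats_power:
  fixes q :: real
  assumes "0 < q" "q < 1"
  obtains M where "0 < M" "q ^ M \<le> (1 / (2 * real M)) ^ n / 6"
proof -
  have "(\<lambda>M. q ^ M * (2 * real M) ^ n) \<longlonglongrightarrow> 0"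
    using assms by real_asymp
  then have "\<forall>\<^sub>F M in sequentially. q ^ M * (2 * real M) ^ n < 1 / 6"
    by (rule order_tendstoD) simp
  moreover have "\<forall>\<^sub>F M in sequentially. 0 < (M::nat)"
    by (rule eventually_gt_at_top)
  ultimately have "\<forall>\<^sub>F M in sequentially. 0 < M \<and> q ^ M \<le> (1 / (2 * real M)) ^ n / 6"
    by eventually_elim (simp add: field_simps)
  then show ?thesis
    using that eventually_happens'[OF sequentially_bot] by blast
qed

section \<open>Trigonometric polynomials with frequencies in \<open>G\<close>\<close>

locale unit_subgroup =
  fixes G :: "complex set"
  assumes norm_eq_1: "z \<in> G \<Longrightarrow> norm z = 1"
    and one_mem: "1 \<in> G"
    and mult_mem: "z \<in> G \<Longrightarrow> w \<in> G \<Longrightarrow> z * w \<in> G"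
    and inverse_mem: "z \<in> G \<Longrightarrow> inverse z \<in> G"
begin

lemma power_mem: "z \<in> G \<Longrightarrow> z ^ n \<in> G"
  by (induction n) (auto intro: one_mem mult_mem)

text \<open>\<open>m\<close> is a lower bound for the constant coefficient, which is the mean value of \<open>f\<close>.\<close>

definition trig_poly :: "real \<Rightarrow> (nat \<Rightarrow> real) \<Rightarrow> bool" where
  "trig_poly m f \<longleftrightarrow> (\<exists>W c. finite W \<and> W \<subseteq> G \<and> 1 \<in> W \<and> (\<forall>w\<in>W. (0::real) \<le> c w) \<and> m \<le> c 1 \<and>
     (\<forall>k. complex_of_real (f k) = (\<Sum>w\<in>W. of_real (c w) * w ^ k)))"

text \<open>Frequencies may repeat in the indexed family: coefficients of equal frequencies are
  added, and frequency 1 gets coefficient 0 if it is absent.\<close>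

lemma trig_polyI:
  fixes a :: "'i \<Rightarrow> real"
  assumes "finite J" and "\<And>j. j \<in> J \<Longrightarrow> 0 \<le> a j" and "\<And>j. j \<in> J \<Longrightarrow> \<omega> j \<in> G"
    and "m \<le> (\<Sum>j\<in>{j \<in> J. \<omega> j = 1}. a j)"
    and "\<And>k. complex_of_real (f k) = (\<Sum>j\<in>J. of_real (a j) * \<omega> j ^ k)"
  shows "trig_poly m f"
  unfolding trig_poly_def
proof (intro exI conjI allI)
  let ?W = "insert 1 (\<omega> ` J)"
  let ?c = "\<lambda>w. \<Sum>j\<in>{j \<in> J. \<omega> j = w}. a j"
  show "finite ?W" "?W \<subseteq> G" "1 \<in> ?W" "\<forall>w\<in>?W. 0 \<le> ?c w" "m \<le> ?c 1"
    using assms by (auto intro: sum_nonneg one_mem)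
  fix k
  have "(\<Sum>w\<in>?W. of_real (?c w) * w ^ k) = (\<Sum>w\<in>?W. \<Sum>j\<in>{j \<in> J. \<omega> j = w}. of_real (a j) * \<omega> j ^ k)"
    by (intro sum.cong) (auto simp: sum_distrib_right)
  also have "\<dots> = (\<Sum>j\<in>J. of_real (a j) * \<omega> j ^ k)"
    by (rule sum.group) (use assms(1) in auto)
  finally show "complex_of_real (f k) = (\<Sum>w\<in>?W. of_real (?c w) * w ^ k)"
    using assms(5) by simp
qed

text \<open>Nonnegative coefficients cannot cancel, so the pair \<open>(1, 1)\<close> alone secures
  \<open>m * n\<close> in the constant coefficient.\<close>

lemma trig_poly_mult:
  assumes "trig_poly m f" "trig_poly n g" "0 \<le> m" "0 \<le> n"
  shows "trig_poly (m * n) (\<lambda>k. f k * g k)"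
proof -
  from assms(1) obtain W c where W: "finite W" "W \<subseteq> G" "1 \<in> W" "\<forall>w\<in>W. (0::real) \<le> c w" "m \<le> c 1"
    "\<And>k. complex_of_real (f k) = (\<Sum>w\<in>W. of_real (c w) * w ^ k)"
    unfolding trig_poly_def by blast
  from assms(2) obtain V d where V: "finite V" "V \<subseteq> G" "1 \<in> V" "\<forall>w\<in>V. (0::real) \<le> d w" "n \<le> d 1"
    "\<And>k. complex_of_real (g k) = (\<Sum>w\<in>V. of_real (d w) * w ^ k)"
    unfolding trig_poly_def by blast
  show ?thesis
  proof (rule trig_polyI[of "W \<times> V" "\<lambda>(w, v). c w * d v" "\<lambda>(w, v). w * v"])
    let ?S = "{j \<in> W \<times> V. (case j of (w, v) \<Rightarrow> w * v) = 1}"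
    have "m * n \<le> (case (1, 1) of (w, v) \<Rightarrow> c w * d v)"
      using W V assms by (auto intro!: mult_mono)
    also have "\<dots> \<le> (\<Sum>j\<in>?S. case j of (w, v) \<Rightarrow> c w * d v)"
      by (rule member_le_sum) (use W V in \<open>auto intro: finite_subset[OF _ finite_cartesian_product]\<close>)
    finally show "m * n \<le> (\<Sum>j\<in>?S. case j of (w, v) \<Rightarrow> c w * d v)" .
    show "complex_of_real (f k * g k)
      = (\<Sum>j\<in>W \<times> V. of_real (case j of (w, v) \<Rightarrow> c w * d v) * (case j of (w, v) \<Rightarrow> w * v) ^ k)" for k
      by (simp add: W(6) V(6) sum_product sum.cartesian_product case_prod_unfold power_mult_distrib mult_ac)
  qed (use W V in \<open>auto intro: mult_mem\<close>)
qed

lemma trig_poly_prod: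
  assumes "finite S" "0 \<le> m" "\<And>z. z \<in> S \<Longrightarrow> trig_poly m (f z)"
  shows "trig_poly (m ^ card S) (\<lambda>k. \<Prod>z\<in>S. f z k)"
  using assms(1,3)
proof (induction S rule: finite_induct)
  case empty
  show ?case
    by (rule trig_polyI[of "{1::complex}" "\<lambda>_. 1" "\<lambda>_. 1"]) (auto intro: one_mem)
next
  case (insert z S)
  then show ?case
    using trig_poly_mult[of m "f z" "m ^ card S"] assms(2) by simp
qed

text \<open>For \<open>w\<close> of modulus 1,
  \<open>(norm (1 + w))\<^sup>2 = inverse w * (w + 1)\<^sup>2\<close>; its power \<open>M\<close> is
  expanded binomially. The term \<open>j = M\<close> has frequency 1 and carries the central
  binomial coefficient.\<close>

lemma trig_poly_kernel:
  assumes "z \<in> G" "0 < M"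
  shows "trig_poly (1 / (2 * real M)) (\<lambda>k. (norm (1 + z ^ k) / 2) ^ (2 * M))"
proof (rule trig_polyI[of "{..2*M}" "\<lambda>j. real ((2*M) choose j) / 4 ^ M" "\<lambda>j. z ^ j * inverse z ^ M"])
  let ?S = "{j \<in> {..2*M}. z ^ j * inverse z ^ M = 1}"
  have z: "norm z = 1" "z \<noteq> 0"
    using norm_eq_1[OF assms(1)] by auto
  have "1 / (2 * real M) \<le> real ((2*M) choose M) / 4 ^ M"
    using central_binomial_lower_bound[OF assms(2)] assms(2) by (simp add: field_simps)
  also have "\<dots> \<le> (\<Sum>j\<in>?S. real ((2*M) choose j) / 4 ^ M)"
    by (rule member_le_sum) (use z in \<open>auto simp: power_inverse\<close>)
  finally show "1 / (2 * real M) \<le> (\<Sum>j\<in>?S. real ((2*M) choose j) / 4 ^ M)" .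
  fix k
  define w where "w = z ^ k"
  have w: "norm w = 1" "w \<noteq> 0"
    using z by (auto simp: w_def norm_power)
  have "complex_of_real ((norm (1 + w))\<^sup>2) = (1 + w) * cnj (1 + w)"
    by (rule complex_norm_square)
  also have "cnj w = inverse w"
    using w by (simp add: inverse_complex_def complex_eq_iff cmod_def)
  then have "(1 + w) * cnj (1 + w) = inverse w * (w + 1)\<^sup>2"
    using w by (simp add: field_simps power2_eq_square)
  finally have *: "complex_of_real ((norm (1 + w))\<^sup>2) = inverse w * (w + 1)\<^sup>2" .
  have "complex_of_real ((norm (1 + w) / 2) ^ (2 * M)) = (complex_of_real ((norm (1 + w))\<^sup>2)) ^ M / 4 ^ M"
    by (simp add: power_divide power_mult)
  also have "\<dots> = inverse w ^ M * (w + 1) ^ (2 * M) / 4 ^ M"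
    by (simp only: * power_mult_distrib power_mult)
  also have "\<dots> = (\<Sum>j\<le>2*M. of_real (real ((2*M) choose j) / 4 ^ M) * (w ^ j * inverse w ^ M))"
    by (simp add: binomial_ring sum_distrib_left sum_divide_distrib mult_ac)
  also have "\<dots> = (\<Sum>j\<le>2*M. of_real (real ((2*M) choose j) / 4 ^ M) * (z ^ j * inverse z ^ M) ^ k)"
    by (intro sum.cong refl arg_cong2[of _ _ _ _ "(*)"])
       (simp add: w_def power_mult_distrib power_inverse mult.commute flip: power_mult)
  finally show "complex_of_real ((norm (1 + z ^ k) / 2) ^ (2 * M)) =
      (\<Sum>j\<le>2*M. of_real (real ((2*M) choose j) / 4 ^ M) * (z ^ j * inverse z ^ M) ^ k)"
    by (simp only: w_def)
qed (use assms in \<open>auto intro: mult_mem power_mem inverse_mem\<close>)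

text \<open>Frequency 1 contributes \<open>c 1 * real L\<close>; each other frequency contributes a
  geometric sum bounded independently of \<open>a\<close> and \<open>L\<close>.\<close>

lemma trig_poly_sum_ge:
  assumes "trig_poly m f"
  obtains D where "\<And>a L. m * real L - D \<le> (\<Sum>k\<in>{a..<a+L}. f k)"
proof -
  from assms obtain W c where W: "finite W" "W \<subseteq> G" "1 \<in> W" "\<forall>w\<in>W. (0::real) \<le> c w" "m \<le> c 1"
    "\<And>k. complex_of_real (f k) = (\<Sum>w\<in>W. of_real (c w) * w ^ k)"
    unfolding trig_poly_def by blast
  define D where "D = (\<Sum>w\<in>W-{1}. c w * (2 / norm (w - 1)))"
  have "m * real L - D \<le> (\<Sum>k\<in>{a..<a+L}. f k)" for a L
  proof -
    let ?e = "\<Sum>w\<in>W-{1}. of_real (c w) * (\<Sum>k\<in>{a..<a+L}. w ^ k)"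
    have "complex_of_real (\<Sum>k\<in>{a..<a+L}. f k) = (\<Sum>w\<in>W. of_real (c w) * (\<Sum>k\<in>{a..<a+L}. w ^ k))"
      by (simp add: W(6) sum_distrib_left) (rule sum.swap)
    also have "\<dots> = of_real (c 1 * real L) + ?e"
      using W by (subst sum.remove[of _ 1]) auto
    finally have "(\<Sum>k\<in>{a..<a+L}. f k) = c 1 * real L + Re ?e"
      by (metis Re_complex_of_real plus_complex.sel(1))
    moreover have "norm ?e \<le> D"
      unfolding D_def
    proof (rule sum_norm_le)
      fix w assume "w \<in> W - {1}"
      then show "norm (of_real (c w) * (\<Sum>k\<in>{a..<a+L}. w ^ k)) \<le> c w * (2 / norm (w - 1))"
        using W mult_left_mono[OF norm_geometric_sum_le[of w a L], of "c w"] norm_eq_1[of w]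
        by (auto simp: norm_mult)
    qed
    moreover have "- norm ?e \<le> Re ?e"
      using abs_Re_le_cmod[of ?e] by linarith
    moreover have "m * real L \<le> c 1 * real L"
      using W by (simp add: mult_right_mono)
    ultimately show ?thesis by linarith
  qed
  then show ?thesis using that by blast
qed

text \<open>The factor \<open>z ^ k\<close> turns a frequency \<open>w\<close> into
  \<open>w * z\<close>, which is near 1 only if \<open>z\<close> is near \<open>inverse w\<close>.
  Hence the set sought consists of the inverse frequencies, and it is fixed before
  \<open>\<delta>\<close>.\<close>

lemma trig_poly_twisted_sum_le:
  assumes "trig_poly m f"
  obtains W C where "finite W" "W \<subseteq> G"
    "\<And>\<delta> z a L. 0 < \<delta> \<Longrightarrow> norm z = 1 \<Longrightarrow> (\<And>w. w \<in> W \<Longrightarrow> \<delta> \<le> norm (z - w)) \<Longrightarrow>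
       norm (\<Sum>k\<in>{a..<a+L}. of_real (f k) * z ^ k) \<le> C / \<delta>"
proof -
  from assms obtain W c where W: "finite W" "W \<subseteq> G" "1 \<in> W" "\<forall>w\<in>W. (0::real) \<le> c w" "m \<le> c 1"
    "\<And>k. complex_of_real (f k) = (\<Sum>w\<in>W. of_real (c w) * w ^ k)"
    unfolding trig_poly_def by blast
  have "norm (\<Sum>k\<in>{a..<a+L}. of_real (f k) * z ^ k) \<le> (\<Sum>w\<in>W. c w * 2) / \<delta>"
    if "0 < \<delta>" "norm z = 1" and far: "\<And>w. w \<in> inverse ` W \<Longrightarrow> \<delta> \<le> norm (z - w)" for \<delta> z a L
  proof -
    have "(\<Sum>k\<in>{a..<a+L}. of_real (f k) * z ^ k)
      = (\<Sum>w\<in>W. of_real (c w) * (\<Sum>k\<in>{a..<a+L}. (w * z) ^ k))"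
      by (simp add: W(6) sum_distrib_left sum_distrib_right power_mult_distrib mult_ac) (rule sum.swap)
    also have "norm \<dots> \<le> (\<Sum>w\<in>W. c w * 2 / \<delta>)"
    proof (rule sum_norm_le)
      fix w assume w: "w \<in> W"
      then have nw: "norm w = 1" using W norm_eq_1 by auto
      then have "w * z - 1 = w * (z - inverse w)"
        by (cases "w = 0") (auto simp: algebra_simps)
      then have "norm (w * z - 1) = norm (z - inverse w)"
        using nw by (simp add: norm_mult)
      then have ge: "\<delta> \<le> norm (w * z - 1)"
        using far w by simp
      with \<open>0 < \<delta>\<close> have "norm (\<Sum>k\<in>{a..<a+L}. (w * z) ^ k) \<le> 2 / norm (w * z - 1)"
        using nw that by (intro norm_geometric_sum_le) (auto simp: norm_mult)
      also have "\<dots> \<le> 2 / \<delta>"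
        using ge \<open>0 < \<delta>\<close> by (simp add: frac_le)
      finally show "norm (of_real (c w) * (\<Sum>k\<in>{a..<a+L}. (w * z) ^ k)) \<le> c w * 2 / \<delta>"
        using W w mult_left_mono[of _ "2 / \<delta>" "c w"] by (simp add: norm_mult)
    qed
    also have "\<dots> = (\<Sum>w\<in>W. c w * 2) / \<delta>"
      by (simp add: sum_divide_distrib)
    finally show ?thesis .
  qed
  then show ?thesis
    using W by (intro that[of "inverse ` W"]) (auto intro: inverse_mem)
qed

section \<open>Bohr sets: density and detection\<close>

definition bohr :: "complex set \<Rightarrow> real \<Rightarrow> nat set" where
  "bohr S \<rho> = {k. \<forall>z\<in>S. norm (z ^ k - 1) < \<rho>}"

lemma bohr_mono: "\<rho> \<le> \<rho>' \<Longrightarrow> S' \<subseteq> S \<Longrightarrow> bohr S \<rho> \<subseteq> bohr S' \<rho>'"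
  by (force simp: bohr_def)

lemma bohr_kernel:
  assumes "finite S" "S \<subseteq> G" "0 < \<rho>" "\<rho> \<le> 1"
  obtains m P where "0 < m" "trig_poly m P" "\<And>k. 0 \<le> P k" "\<And>k. P k \<le> 1"
    "\<And>k. k \<notin> bohr S \<rho> \<Longrightarrow> P k \<le> m / 6"
proof -
  \<comment> \<open>By the parallelogram law, \<open>(norm (1 + z ^ k) / 2)\<^sup>2 \<le> q\<close>
    as soon as \<open>\<rho> \<le> norm (z ^ k - 1)\<close>. Off the Bohr set one factor of the
    product is this small, and the others are at most 1.\<close>
  define q where "q = 1 - \<rho>\<^sup>2 / 4"
  have "\<rho>\<^sup>2 \<le> 1" "0 < \<rho>\<^sup>2"
    using assms by (auto simp: power_le_one)
  then have q: "0 < q" "q < 1"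
    by (auto simp: q_def)
  then obtain M where M: "0 < M" "q ^ M \<le> (1 / (2 * real M)) ^ card S / 6"
    by (rule exponential_beats_power)
  define K :: "complex \<Rightarrow> nat \<Rightarrow> real" where "K = (\<lambda>z k. (norm (1 + z ^ k) / 2) ^ (2 * M))"
  have K01: "0 \<le> K z k \<and> K z k \<le> 1" if "z \<in> S" for z k
  proof -
    have "norm (1 + z ^ k) \<le> 2"
      using norm_triangle_ineq[of 1 "z ^ k"] norm_eq_1[of z] that assms by (auto simp: norm_power)
    then show ?thesis
      by (auto simp: K_def intro!: power_le_one)
  qed
  show ?thesis
  proof (rule that[of "(1 / (2 * real M)) ^ card S" "\<lambda>k. \<Prod>z\<in>S. K z k"])
    show "trig_poly ((1 / (2 * real M)) ^ card S) (\<lambda>k. \<Prod>z\<in>S. K z k)"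
      by (rule trig_poly_prod) (use assms M trig_poly_kernel in \<open>auto simp: K_def\<close>)
    show "0 < (1 / (2 * real M)) ^ card S"
      using M by simp
    show "0 \<le> (\<Prod>z\<in>S. K z k)" for k
      by (rule prod_nonneg) (use K01 in auto)
    show "(\<Prod>z\<in>S. K z k) \<le> 1" for k
      by (rule prod_le_1) (use K01 in auto)
    fix k assume "k \<notin> bohr S \<rho>"
    then obtain z where z: "z \<in> S" "\<rho> \<le> norm (z ^ k - 1)"
      by (auto simp: bohr_def not_less)
    have "norm (z ^ k) = 1"
      using z assms norm_eq_1 by (auto simp: norm_power)
    then have "(norm (1 + z ^ k))\<^sup>2 = 4 - (norm (z ^ k - 1))\<^sup>2"
      by (rule norm_1_plus_power2)
    also have "\<dots> \<le> 4 * q"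
      using z assms by (simp add: q_def power_mono)
    finally have "(norm (1 + z ^ k) / 2)\<^sup>2 \<le> q"
      by (simp add: power_divide)
    then have "K z k \<le> q ^ M"
      unfolding K_def power_mult by (rule power_mono) simp
    moreover have "(\<Prod>z\<in>S. K z k) \<le> K z k"
    proof -
      have "(\<Prod>z\<in>S. K z k) = K z k * (\<Prod>z\<in>S-{z}. K z k)"
        using z assms by (simp add: prod.remove)
      also have "\<dots> \<le> K z k"
        using K01 z by (intro mult_left_le prod_le_1) auto
      finally show ?thesis .
    qed
    ultimately show "(\<Prod>z\<in>S. K z k) \<le> (1 / (2 * real M)) ^ card S / 6"
      using M by linarith
  qed
qed

text \<open>Points off the Bohr set contribute at most \<open>m / 6\<close> each to a sum of about
  \<open>m * L\<close>, and points of it at most 1 each, so the latter must be numerous.\<close>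

lemma bohr_dense:
  assumes "finite S" "S \<subseteq> G" "0 < \<rho>" "\<rho> \<le> 1"
  shows "\<exists>d>0. \<exists>L0. \<forall>a. \<forall>L\<ge>L0. d * real L \<le> card (bohr S \<rho> \<inter> {a..<a+L})"
proof -
  obtain m P where P: "0 < m" "trig_poly m P" "\<And>k. 0 \<le> P k" "\<And>k. P k \<le> 1"
    "\<And>k. k \<notin> bohr S \<rho> \<Longrightarrow> P k \<le> m / 6"
    using bohr_kernel[OF assms] by blast
  obtain D where D: "\<And>a L. m * real L - D \<le> (\<Sum>k\<in>{a..<a+L}. P k)"
    using trig_poly_sum_ge[OF P(2)] by blast
  \<comment> \<open>The count is at least \<open>5 / 6 * m * L - D\<close>; the length required of
    \<open>L\<close> gives \<open>D \<le> 2 / 3 * m * L\<close>, which leaves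
    \<open>m / 6 * L\<close>.\<close>
  have "m / 6 * real L \<le> card (bohr S \<rho> \<inter> {a..<a+L})" if "nat \<lceil>3 * D / (2 * m)\<rceil> \<le> L" for a L
  proof -
    have "(\<Sum>k\<in>{a..<a+L}. P k) \<le> (\<Sum>k\<in>{a..<a+L}. (if k \<in> bohr S \<rho> then 1 else 0) + m / 6)"
      by (rule sum_mono) (use P in \<open>auto intro: add_increasing2\<close>)
    also have "\<dots> = card (bohr S \<rho> \<inter> {a..<a+L}) + m / 6 * L"
      by (simp add: sum.distrib sum.If_cases Int_commute)
    finally have "m * real L - D \<le> card (bohr S \<rho> \<inter> {a..<a+L}) + m / 6 * L"
      using D order_trans by blast
    moreover have "3 * D / (2 * m) \<le> L"
      using that by linarith
    then have "D \<le> 2 / 3 * m * L"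
      using \<open>0 < m\<close> by (simp add: field_simps)
    ultimately show ?thesis
      by (simp add: algebra_simps)
  qed
  then show ?thesis
    using \<open>0 < m\<close> by (intro exI[of _ "m / 6"] conjI exI[of _ "nat \<lceil>3 * D / (2 * m)\<rceil>"] allI impI) simp_all
qed

text \<open>One \<open>T\<close> serves every starting point \<open>a\<close>, so that a stage of
  the construction may begin anywhere.\<close>

definition detects :: "nat set \<Rightarrow> complex set \<Rightarrow> real \<Rightarrow> nat \<Rightarrow> bool" where
  "detects B W \<delta> T \<longleftrightarrow> (\<forall>a L z. T \<le> L \<longrightarrow> norm z = 1 \<longrightarrow>
    (\<forall>k\<in>B \<inter> {a..<a+L}. norm (z ^ k - 1) \<le> 1) \<longrightarrow> (\<exists>w\<in>W. norm (z - w) < \<delta>))"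

text \<open>If \<open>z\<close> were far from \<open>W\<close>, the frequencies of \<open>P\<close> up to inversion, then the average of
  \<open>P k * z ^ k\<close> would be small; but \<open>P\<close> is concentrated on the Bohr set, where \<open>Re (z ^ k) \<ge> 1 / 2\<close>.\<close>

lemma bohr_detects:
  assumes "finite S" "S \<subseteq> G" "0 < \<rho>" "\<rho> \<le> 1"
  shows "\<exists>W. finite W \<and> W \<subseteq> G \<and> (\<forall>\<delta>>0. \<exists>T. detects (bohr S \<rho>) W \<delta> T)"
proof -
  obtain m P where P: "0 < m" "trig_poly m P" "\<And>k. 0 \<le> P k" "\<And>k. P k \<le> 1"
    "\<And>k. k \<notin> bohr S \<rho> \<Longrightarrow> P k \<le> m / 6"
    using bohr_kernel[OF assms] by blast
  obtain D where D: "\<And>a L. m * real L - D \<le> (\<Sum>k\<in>{a..<a+L}. P k)"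
    using trig_poly_sum_ge[OF P(2)] by blast
  obtain W C where W: "finite W" "W \<subseteq> G"
    "\<And>\<delta> z a L. 0 < \<delta> \<Longrightarrow> norm z = 1 \<Longrightarrow> (\<And>w. w \<in> W \<Longrightarrow> \<delta> \<le> norm (z - w)) \<Longrightarrow>
       norm (\<Sum>k\<in>{a..<a+L}. of_real (P k) * z ^ k) \<le> C / \<delta>"
    using trig_poly_twisted_sum_le[OF P(2)] by blast
  have near: "\<exists>w\<in>W. norm (z - w) < \<delta>"
    if \<delta>: "0 < \<delta>" and L: "nat \<lceil>(4 * C / \<delta> + 2 * D) / m\<rceil> + 1 \<le> L" and z: "norm z = 1"
      and small: "\<forall>k\<in>bohr S \<rho> \<inter> {a..<a+L}. norm (z ^ k - 1) \<le> 1" for \<delta> a L z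
  proof (rule ccontr)
    assume "\<not> ?thesis"
    then have "norm (\<Sum>k\<in>{a..<a+L}. of_real (P k) * z ^ k) \<le> C / \<delta>"
      using W(3)[OF \<delta> z] by (meson not_less)
    then have "(\<Sum>k\<in>{a..<a+L}. P k * Re (z ^ k)) \<le> C / \<delta>"
      using complex_Re_le_cmod[of "\<Sum>k\<in>{a..<a+L}. of_real (P k) * z ^ k"] by simp
    \<comment> \<open>On the Bohr set \<open>Re (z ^ k) \<ge> 1 / 2\<close>. Off it only
      \<open>Re (z ^ k) \<ge> - 1\<close> is known, but \<open>- P k \<ge> P k / 2 - m / 4\<close>
      is exactly \<open>P k \<le> m / 6\<close>: this is the origin of the 6.\<close>
    moreover have "(\<Sum>k\<in>{a..<a+L}. P k / 2 - m / 4) \<le> (\<Sum>k\<in>{a..<a+L}. P k * Re (z ^ k))"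
    proof (rule sum_mono)
      fix k assume k: "k \<in> {a..<a+L}"
      have zk: "norm (z ^ k) = 1"
        using z by (simp add: norm_power)
      show "P k / 2 - m / 4 \<le> P k * Re (z ^ k)"
      proof (cases "k \<in> bohr S \<rho>")
        case True
        then have "(norm (z ^ k - 1))\<^sup>2 \<le> 1"
          using small k by (simp add: power_le_one)
        moreover have "(norm (z ^ k))\<^sup>2 = 1"
          by (simp only: zk one_power2)
        \<comment> \<open>On the unit circle
          \<open>(norm (z ^ k - 1))\<^sup>2 = 2 - 2 * Re (z ^ k)\<close>.\<close>
        ultimately have "1 / 2 \<le> Re (z ^ k)"
          unfolding cmod_power2 by (simp add: power2_eq_square algebra_simps)
        then have "P k * (1 / 2) \<le> P k * Re (z ^ k)"
          using P(3) by (rule mult_left_mono)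
        then show ?thesis
          using \<open>0 < m\<close> by simp
      next
        case False
        have "- 1 \<le> Re (z ^ k)"
          using abs_Re_le_cmod[of "z ^ k"] zk by linarith
        then have "P k * (- 1) \<le> P k * Re (z ^ k)"
          using P(3) by (rule mult_left_mono)
        then show ?thesis
          using P(5)[OF False] by simp
      qed
    qed
    moreover have "(\<Sum>k\<in>{a..<a+L}. P k / 2 - m / 4) = (\<Sum>k\<in>{a..<a+L}. P k) / 2 - m / 4 * L"
      by (simp add: sum_subtractf sum_divide_distrib)
    \<comment> \<open>This amounts to \<open>m * L \<le> 4 * C / \<delta> + 2 * D\<close>, which the
      length required of \<open>L\<close> excludes.\<close>
    ultimately have "m * L - D \<le> 2 * (C / \<delta>) + m / 2 * L"
      using D[of L a] by simp
    moreover have "(4 * C / \<delta> + 2 * D) / m < L"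
      using L by linarith
    then have "4 * C / \<delta> + 2 * D < m * L"
      using \<open>0 < m\<close> by (simp add: pos_divide_less_eq mult.commute)
    ultimately show False
      by simp
  qed
  have "detects (bohr S \<rho>) W \<delta> (nat \<lceil>(4 * C / \<delta> + 2 * D) / m\<rceil> + 1)" if "0 < \<delta>" for \<delta>
    unfolding detects_def by (intro allI impI) (rule near[OF that])
  then have "\<forall>\<delta>>0. \<exists>T. detects (bohr S \<rho>) W \<delta> T"
    by blast
  then show ?thesis
    using W(1,2) by (intro exI[of _ W] conjI)
qed

section \<open>Construction of the set in stages\<close>

text \<open>The finiteness conditions express convergence along \<open>A\<close> without fixing an
  enumeration. Membership in \<open>G\<close> already follows from the single threshold 1.\<close>

lemma dense_characterizing_set:
  fixes \<epsilon> :: "nat \<Rightarrow> real" and i :: "nat \<Rightarrow> nat"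
  assumes "countable G" and \<epsilon>: "\<And>j. \<epsilon> j \<le> 1" "\<epsilon> \<longlonglongrightarrow> 0"
    and i: "i 0 = 0" "strict_mono i" "filterlim (\<lambda>j. i (Suc j) - i j) at_top sequentially"
  obtains A where "infinite A"
    and "\<And>z \<eta>. z \<in> G \<Longrightarrow> 0 < \<eta> \<Longrightarrow> finite {k \<in> A. \<eta> \<le> norm (z ^ k - 1)}"
    and "\<And>z. norm z = 1 \<Longrightarrow> finite {k \<in> A. 1 < norm (z ^ k - 1)} \<Longrightarrow> z \<in> G"
    and "\<And>j. \<epsilon> j * real (i (Suc j) - i j) \<le> card (A \<inter> {i j..<i (Suc j)})"
proof -
  \<comment> \<open>\<open>from_nat_into\<close> lists a finite \<open>G\<close> as well, with
    repetitions.\<close>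
  define g where "g = from_nat_into G"
  have range_g: "range g = G"
    unfolding g_def using assms(1) one_mem by (intro range_from_nat_into) auto
  define B where "B = (\<lambda>r. bohr (g ` {..r}) (1 / real (Suc r)))"
  have B_antimono: "B r \<subseteq> B r'" if "r' \<le> r" for r r'
  proof -
    have "1 / real (Suc r) \<le> 1 / real (Suc r')"
      using that by (simp add: frac_le)
    moreover have "g ` {..r'} \<subseteq> g ` {..r}"
      using that by auto
    ultimately show ?thesis
      unfolding B_def by (rule bohr_mono)
  qed
  have "\<forall>r. \<exists>d>0. \<exists>L0. \<forall>a. \<forall>L\<ge>L0. d * real L \<le> card (B r \<inter> {a..<a+L})"
    unfolding B_def using range_g by (intro allI bohr_dense) auto
  from choice[OF this] obtain d where d0: "\<forall>r. 0 < d r \<and>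
      (\<exists>L0. \<forall>a. \<forall>L\<ge>L0. d r * real L \<le> card (B r \<inter> {a..<a+L}))"
    by (elim exE)
  then have "\<forall>r. \<exists>L0. \<forall>a. \<forall>L\<ge>L0. d r * real L \<le> card (B r \<inter> {a..<a+L})"
    by simp
  from choice[OF this] obtain L0 where
    "\<forall>r. \<forall>a. \<forall>L\<ge>L0 r. d r * real L \<le> card (B r \<inter> {a..<a+L})"
    by (elim exE)
  with d0 have d: "\<And>r. 0 < d r"
    "\<And>r a L. L0 r \<le> L \<Longrightarrow> d r * real L \<le> card (B r \<inter> {a..<a+L})"
    by simp_all
  have "\<forall>r. \<exists>W. finite W \<and> W \<subseteq> G \<and> (\<forall>\<delta>>0. \<exists>T. detects (B r) W \<delta> T)"
    unfolding B_def using range_g by (intro allI bohr_detects) auto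
  then obtain W where W: "\<And>r. finite (W r)" "\<And>r. W r \<subseteq> G"
    "\<And>r \<delta>. 0 < \<delta> \<Longrightarrow> \<exists>T. detects (B r) (W r) \<delta> T"
    by metis
  \<comment> \<open>A point within \<open>\<delta>\<close> of both \<open>u \<in> W r\<close> and
    \<open>v \<in> W (Suc r)\<close> forces \<open>u = v\<close>. The bound
    \<open>1 / real (Suc r)\<close> makes the tolerances tend to 0.\<close>
  define good where "good = (\<lambda>r \<delta>. 0 < \<delta> \<and> \<delta> \<le> 1 / real (Suc r) \<and>
      (\<forall>u\<in>W r. \<forall>v\<in>W (Suc r). u \<noteq> v \<longrightarrow> 2 * \<delta> \<le> norm (u - v)))"
  have good_ex: "\<exists>\<delta>. good r \<delta> \<and> \<delta> \<le> e" if "0 < e" for r e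
  proof -
    \<comment> \<open>Only distinct pairs enter, so the minimum is positive. In the recursion
      \<open>e\<close> is the preceding tolerance, which makes the tolerances nonincreasing.\<close>
    let ?X = "insert e (insert (1 / real (Suc r))
       ((\<lambda>(u, v). norm (u - v) / 2) ` {(u, v) \<in> W r \<times> W (Suc r). u \<noteq> v}))"
    have "finite {(u, v) \<in> W r \<times> W (Suc r). u \<noteq> v}"
      by (rule finite_subset[of _ "W r \<times> W (Suc r)"]) (use W in auto)
    then have fin: "finite ?X"
      by simp
    have "Min ?X \<in> ?X"
      using fin by (intro Min_in) auto
    moreover have "\<forall>x\<in>?X. 0 < x"
      using that by auto
    ultimately have pos: "0 < Min ?X"
      by blast
    have le: "Min ?X \<le> x" if "x \<in> ?X" for x
      using fin that by (rule Min_le)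
    have "2 * Min ?X \<le> norm (u - v)" if "u \<in> W r" "v \<in> W (Suc r)" "u \<noteq> v" for u v
      using le[of "norm (u - v) / 2"] that by force
    then show ?thesis
      using pos le unfolding good_def by (intro exI[of _ "Min ?X"]) blast
  qed
  have "\<exists>\<delta>. \<forall>r. good r (\<delta> r) \<and> \<delta> (Suc r) \<le> \<delta> r"
    by (rule dependent_nat_choice) (use good_ex good_def in \<open>meson zero_less_one, blast\<close>)
  then obtain \<delta> where \<delta>: "\<And>r. good r (\<delta> r)" "\<And>r. \<delta> (Suc r) \<le> \<delta> r"
    by blast
  have "\<forall>r. \<exists>T. detects (B r) (W r) (\<delta> r) T"
    using W(3) \<delta>(1) unfolding good_def by blast
  then obtain T where T: "\<And>r. detects (B r) (W r) (\<delta> r) (T r)"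
    by metis
  \<comment> \<open>From block \<open>J\<close> on, blocks are long enough for the density estimate
    of \<open>B r\<close>, and that density exceeds the demand \<open>\<epsilon> j\<close>.\<close>
  define late where "late = (\<lambda>r J. \<forall>j\<ge>J. L0 r \<le> i (Suc j) - i j \<and> \<epsilon> j \<le> d r)"
  have late_ex: "\<exists>J. late r J \<and> n \<le> J" for r n
  proof -
    have "\<forall>\<^sub>F j in sequentially. L0 r \<le> i (Suc j) - i j"
      using i(3) by (simp add: filterlim_at_top)
    moreover have "\<forall>\<^sub>F j in sequentially. \<epsilon> j \<le> d r"
      using order_tendstoD(2)[OF \<epsilon>(2) d(1)[of r]] by eventually_elim simp
    ultimately have "\<forall>\<^sub>F j in sequentially. L0 r \<le> i (Suc j) - i j \<and> \<epsilon> j \<le> d r"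
      by eventually_elim simp
    then obtain J where "late r J"
      unfolding late_def eventually_sequentially by blast
    then show ?thesis
      by (intro exI[of _ "max J n"]) (auto simp: late_def)
  qed
  have i_ge: "n \<le> i n" for n
    using i(2) by (rule strict_mono_imp_increasing)
  \<comment> \<open>Stage \<open>r\<close> starts with block \<open>J r\<close> and lasts at least
    \<open>T r\<close> integers, so that detection applies inside it.\<close>
  have "\<exists>J. \<forall>r. late r (J r) \<and> (J r < J (Suc r) \<and> i (J r) + T r \<le> i (J (Suc r)))"
  proof (rule dependent_nat_choice)
    show "\<exists>J. late 0 J"
      using late_ex by blast
    fix J r
    obtain J' where "late (Suc r) J'" "Suc J + i J + T r \<le> J'"
      using late_ex by blast
    then show "\<exists>J'. late (Suc r) J' \<and> (J < J' \<and> i J + T r \<le> i J')"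
      using i_ge[of J'] by (intro exI[of _ J']) auto
  qed
  then obtain J where J: "\<And>r. late r (J r)" "\<And>r. J r < J (Suc r)"
    "\<And>r. i (J r) + T r \<le> i (J (Suc r))"
    by blast
  have mono_J: "strict_mono J"
    using J(2) by (simp add: strict_mono_Suc_iff)
  define N where "N = (\<lambda>r. i (J r))"
  have mono_N: "strict_mono N"
    unfolding N_def using i(2) mono_J by (simp add: strict_mono_def)
  \<comment> \<open>As \<open>B\<close> is decreasing, \<open>A\<close> agrees with \<open>B r\<close> on \<open>{N r..<N (Suc r)}\<close>, and below \<open>N 0\<close> it contains everything.\<close>
  define A where "A = {k. \<forall>r. N r \<le> k \<longrightarrow> k \<in> B r}"
  have stage: "k \<in> A" if "k \<in> B r" "k < N (Suc r)" for k r
    unfolding A_def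
  proof (intro CollectI allI impI)
    fix r' assume "N r' \<le> k"
    then have "N r' < N (Suc r)"
      using that by simp
    then have "r' \<le> r"
      using mono_N by (simp add: strict_mono_less)
    then show "k \<in> B r'"
      using that B_antimono by blast
  qed
  have i_mono: "i a \<le> i b" if "a \<le> b" for a b
    using i(2) that by (simp add: strict_mono_less_eq)
  have block: "\<exists>r. d r * real (i (Suc j) - i j) \<le> card (A \<inter> {i j..<i (Suc j)}) \<and> \<epsilon> j \<le> d r"
    if "J 0 \<le> j" for j
  proof -
    have "j < J (Suc j)"
      using strict_mono_imp_increasing[OF mono_J, of "Suc j"] by simp
    moreover have "\<not> j < J 0"
      using that by simp
    \<comment> \<open>\<open>r\<close> is the stage of block \<open>j\<close>. Stages begin at block
      boundaries, so the block lies in a single stage.\<close>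
    ultimately have "\<exists>r<Suc j. (\<forall>s\<le>r. \<not> j < J s) \<and> j < J (Suc r)"
      by (rule ex_least_nat_less)
    then obtain r where r: "\<not> j < J r" "j < J (Suc r)"
      by blast
    have "d r * real (i (Suc j) - i j) \<le> card (B r \<inter> {i j..<i j + (i (Suc j) - i j)})"
      using J(1)[of r] r unfolding late_def by (intro d(2)) auto
    also have "i j + (i (Suc j) - i j) = i (Suc j)"
      using i_mono[of j "Suc j"] by simp
    also have "card (B r \<inter> {i j..<i (Suc j)}) \<le> card (A \<inter> {i j..<i (Suc j)})"
      using i_mono[of "Suc j" "J (Suc r)"] r
      by (intro card_mono) (auto intro!: stage simp: N_def)
    finally show ?thesis
      using J(1)[of r] r unfolding late_def by (intro exI[of _ r]) auto
  qed
  show ?thesis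
  proof
    show "infinite A"
      unfolding infinite_nat_iff_unbounded_le
    proof
      fix n
      let ?j = "max n (J 0)"
      have "0 < real (i (Suc ?j) - i ?j)"
        using strict_monoD[OF i(2), of ?j "Suc ?j"] by simp
      moreover obtain r where "d r * real (i (Suc ?j) - i ?j) \<le> card (A \<inter> {i ?j..<i (Suc ?j)})"
        using block[of ?j] by auto
      ultimately have "card (A \<inter> {i ?j..<i (Suc ?j)}) \<noteq> 0"
        using d(1)[of r] by (smt (verit) mult_pos_pos of_nat_0)
      then obtain k where "k \<in> A" "i ?j \<le> k"
        by (metis IntE atLeastLessThan_iff card.empty ex_in_conv)
      then show "\<exists>k\<ge>n. k \<in> A"
        using i_ge[of ?j] by (intro exI[of _ k]) auto
    qed
  next
    fix z \<eta> assume "z \<in> G" "(0::real) < \<eta>"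
    then obtain r0 r1 where r: "z = g r0" "1 / real (Suc r1) < \<eta>"
      using range_g by (metis imageE nat_approx_posE)
    let ?r = "max r0 r1"
    have "1 / real (Suc ?r) \<le> 1 / real (Suc r1)"
      by (simp add: frac_le)
    moreover have "norm (z ^ k - 1) < 1 / real (Suc ?r)" if "k \<in> B ?r" for k
      using that unfolding r(1) B_def bohr_def by auto
    ultimately have "norm (z ^ k - 1) < \<eta>" if "k \<in> B ?r" for k
      using that r(2) by fastforce
    moreover have "k \<in> B ?r" if "k \<in> A" "N ?r \<le> k" for k
      using that by (simp add: A_def)
    ultimately have "k < N ?r" if "k \<in> A" "\<eta> \<le> norm (z ^ k - 1)" for k
      using that by (meson not_less)
    then have "{k \<in> A. \<eta> \<le> norm (z ^ k - 1)} \<subseteq> {..<N ?r}"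
      by auto
    then show "finite {k \<in> A. \<eta> \<le> norm (z ^ k - 1)}"
      by (rule finite_subset) simp
  next
    fix z :: complex assume z: "norm z = 1" and "finite {k \<in> A. 1 < norm (z ^ k - 1)}"
    then obtain K where K: "\<And>k. k \<in> A \<Longrightarrow> 1 < norm (z ^ k - 1) \<Longrightarrow> k < K"
      by (auto simp: finite_nat_set_iff_bounded)
    have "\<forall>r\<ge>K. \<exists>w\<in>W r. norm (z - w) < \<delta> r"
    proof (intro allI impI)
      fix r assume "K \<le> r"
      \<comment> \<open>The first \<open>T r\<close> integers of stage \<open>r\<close> lie within
        the stage, so \<open>A\<close> contains the points of \<open>B r\<close> among them; these
        are at least \<open>N r \<ge> r \<ge> K\<close>, beyond all exceptions.\<close>
      have "norm (z ^ k - 1) \<le> 1" if "k \<in> B r \<inter> {N r..<N r + T r}" for k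
      proof -
        have "r \<le> N r"
          using mono_N by (rule strict_mono_imp_increasing)
        moreover have "N r + T r \<le> N (Suc r)"
          using J(3) by (simp add: N_def)
        ultimately have "k \<in> A" "K \<le> k"
          using that \<open>K \<le> r\<close> by (auto intro: stage)
        then show "norm (z ^ k - 1) \<le> 1"
          using K by force
      qed
      then show "\<exists>w\<in>W r. norm (z - w) < \<delta> r"
        using T[of r] z unfolding detects_def by blast
    qed
    then obtain u where u: "\<And>r. K \<le> r \<Longrightarrow> u r \<in> W r" "\<And>r. K \<le> r \<Longrightarrow> norm (z - u r) < \<delta> r"
      by metis
    have step: "u (Suc r) = u r" if "K \<le> r" for r
    proof (rule ccontr)
      assume "u (Suc r) \<noteq> u r"
      then have "2 * \<delta> r \<le> norm (u r - u (Suc r))"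
        using \<delta>(1)[of r] u(1)[of r] u(1)[of "Suc r"] that unfolding good_def by force
      also have "\<dots> \<le> norm (z - u r) + norm (z - u (Suc r))"
        by (metis norm_minus_commute norm_triangle_ineq add_diff_cancel_left' diff_add_cancel add_diff_eq)
      also have "\<dots> < 2 * \<delta> r"
        using u(2)[of r] u(2)[of "Suc r"] \<delta>(2)[of r] that by simp
      finally show False by simp
    qed
    have const: "u r = u K" if "K \<le> r" for r
      using that by (induction r rule: dec_induct) (simp_all add: step)
    have "norm (z - u K) \<le> 0"
    proof (rule field_le_epsilon)
      fix e :: real assume "0 < e"
      then obtain r where "1 / real (Suc r) < e"
        using nat_approx_posE by blast
      moreover have "1 / real (Suc (max r K)) \<le> 1 / real (Suc r)"
        by (simp add: frac_le)
      moreover have "\<delta> (max r K) \<le> 1 / real (Suc (max r K))"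
        using \<delta>(1) unfolding good_def by blast
      ultimately show "norm (z - u K) \<le> 0 + e"
        using u(2)[of "max r K"] const[of "max r K"] by simp
    qed
    then show "z \<in> G"
      using u(1)[of K] W(2)[of K] by auto
  next
    fix j
    show "\<epsilon> j * real (i (Suc j) - i j) \<le> card (A \<inter> {i j..<i (Suc j)})"
    proof (cases "J 0 \<le> j")
      case True
      then obtain r where "d r * real (i (Suc j) - i j) \<le> card (A \<inter> {i j..<i (Suc j)})" "\<epsilon> j \<le> d r"
        using block by blast
      then show ?thesis
        by (meson mult_right_mono of_nat_0_le_iff order_trans)
    next
      case False
      \<comment> \<open>Before stage 0 no condition is imposed, so the block is full and
        \<open>\<epsilon> j \<le> 1\<close> suffices.\<close>
      have "{i j..<i (Suc j)} \<subseteq> A"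
      proof
        fix k assume "k \<in> {i j..<i (Suc j)}"
        moreover have "i (Suc j) \<le> N 0"
          using False by (simp add: N_def i_mono)
        moreover have "N 0 \<le> N r" for r
          using mono_N by (simp add: strict_mono_less_eq)
        ultimately have "\<not> N r \<le> k" for r
          using order_trans[of "N 0" "N r" k] by auto
        then show "k \<in> A"
          by (simp add: A_def)
      qed
      then have "A \<inter> {i j..<i (Suc j)} = {i j..<i (Suc j)}"
        by blast
      then show ?thesis
        using mult_right_mono[OF \<epsilon>(1)[of j], of "real (i (Suc j) - i j)"] by simp
    qed
  qed
qed

end

section \<open>The circle as the group of complex numbers of modulus 1\<close>

lift_definition circle_cis :: "circle \<Rightarrow> complex" is "\<lambda>x. cis (2 * pi * x)"
proof -
  fix x y :: real assume "x - y \<in> \<int>"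
  then have "cis (2 * pi * (x - y)) = 1"
    by (rule cis_multiple_2pi)
  then show "cis (2 * pi * x) = cis (2 * pi * y)"
    by (simp add: right_diff_distrib flip: cis_divide)
qed

lemma norm_circle_cis: "norm (circle_cis \<alpha>) = 1"
  by transfer simp

lemma circle_cis_0: "circle_cis 0 = 1"
  by transfer simp

lemma circle_cis_add: "circle_cis (\<alpha> + \<beta>) = circle_cis \<alpha> * circle_cis \<beta>"
  by transfer (simp add: cis_mult distrib_left)

lemma circle_cis_minus: "circle_cis (- \<alpha>) = inverse (circle_cis \<alpha>)"
  by transfer simp

lemma circle_cis_int_multiple: "circle_cis (int_multiple (int k) \<alpha>) = circle_cis \<alpha> ^ k"
  by transfer (simp only: Complex.DeMoivre of_int_of_nat_eq mult_ac)

lemma circle_cis_eq_1_iff: "circle_cis \<alpha> = 1 \<longleftrightarrow> \<alpha> = 0"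
proof transfer
  fix x :: real
  have "cis (2 * pi * x) = 1 \<longleftrightarrow> (\<exists>n::int. 2 * pi * x = of_int n * 2 * pi)"
    using exp_eq_1[of "\<i> * of_real (2 * pi * x)"] by (simp add: cis_conv_exp)
  also have "\<dots> \<longleftrightarrow> x - 0 \<in> \<int>"
    by (auto simp: Ints_def)
  finally show "cis (2 * pi * x) = 1 \<longleftrightarrow> x - 0 \<in> \<int>" .
qed

lemma inj_circle_cis: "inj circle_cis"
proof (rule injI)
  fix \<alpha> \<beta> assume "circle_cis \<alpha> = circle_cis \<beta>"
  then have "circle_cis (\<alpha> + - \<beta>) = 1"
    using norm_circle_cis[of \<beta>] unfolding circle_cis_add circle_cis_minus
    by (metis norm_zero right_inverse zero_neq_one)
  then show "\<alpha> = \<beta>"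
    by (simp add: circle_cis_eq_1_iff)
qed

lemma continuous_circle_cis: "continuous_on UNIV circle_cis"
proof (rule continuous_on_open_invariant[THEN iffD2], intro allI impI)
  fix V :: "complex set" assume "open V"
  have "to_circle -` circle_cis -` V = (\<lambda>x. cis (2 * pi * x)) -` V"
    by (auto simp: circle_cis.abs_eq)
  moreover have "open ((\<lambda>x. cis (2 * pi * x)) -` V)"
    using \<open>open V\<close> by (intro open_vimage continuous_intros)
  ultimately have "open (circle_cis -` V)"
    by (simp add: open_circle_def)
  then show "\<exists>A. open A \<and> A \<inter> UNIV = circle_cis -` V \<inter> UNIV"
    by blast
qed

text \<open>For the converse, \<open>Im (Ln w) / (2 * pi)\<close> is a real representative of the
  preimage of \<open>w\<close>, continuous at \<open>w = 1\<close>; convergence is then read off in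
  the quotient topology.\<close>

lemma tendsto_0_iff_circle_cis:
  "(x \<longlongrightarrow> 0) F \<longleftrightarrow> ((\<lambda>n. circle_cis (x n)) \<longlongrightarrow> 1) F"
proof
  assume "(x \<longlongrightarrow> 0) F"
  then show "((\<lambda>n. circle_cis (x n)) \<longlongrightarrow> 1) F"
    using continuous_on_tendsto_compose[OF continuous_circle_cis, of x 0 F] by (simp add: circle_cis_0)
next
  assume lim: "((\<lambda>n. circle_cis (x n)) \<longlongrightarrow> 1) F"
  have x: "x n = to_circle (Im (Ln (circle_cis (x n))) / (2 * pi))" for n
  proof (rule injD[OF inj_circle_cis])
    have "circle_cis (x n) \<noteq> 0"
      using norm_circle_cis[of "x n"] by auto
    then have "circle_cis (x n) = exp (Ln (circle_cis (x n)))"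
      by simp
    also have "\<dots> = cis (Im (Ln (circle_cis (x n))))"
      using norm_circle_cis \<open>circle_cis (x n) \<noteq> 0\<close> by (simp add: exp_eq_polar Re_Ln)
    finally show "circle_cis (x n) = circle_cis (to_circle (Im (Ln (circle_cis (x n))) / (2 * pi)))"
      by (simp add: circle_cis.abs_eq)
  qed
  have "((\<lambda>n. Im (Ln (circle_cis (x n))) / (2 * pi)) \<longlongrightarrow> Im (Ln 1) / (2 * pi)) F"
    by (intro tendsto_intros lim) auto
  then have arg: "((\<lambda>n. Im (Ln (circle_cis (x n))) / (2 * pi)) \<longlongrightarrow> 0) F"
    by simp
  show "(x \<longlongrightarrow> 0) F"
  proof (rule topological_tendstoI)
    fix U :: "circle set" assume "open U" "0 \<in> U"
    then have "open (to_circle -` U)" "0 \<in> to_circle -` U"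
      by (auto simp: open_circle_def zero_circle_def)
    then have "\<forall>\<^sub>F n in F. Im (Ln (circle_cis (x n))) / (2 * pi) \<in> to_circle -` U"
      by (rule topological_tendstoD[OF arg])
    then show "\<forall>\<^sub>F n in F. x n \<in> U"
      by eventually_elim (use x in auto)
  qed
qed

section \<open>Passage from the set to a sequence\<close>

theorem theorem4p1:
  fixes H :: "circle set"
    and \<epsilon> :: "nat \<Rightarrow> real"
    and i :: "nat \<Rightarrow> nat"
    and I :: "nat \<Rightarrow> nat set"
  assumes "is_subgroup H" and "countable H"
    and "\<And>j. 0 \<le> \<epsilon> j" and "\<And>j. \<epsilon> j \<le> 1" and "\<epsilon> \<longlonglongrightarrow> 0"
    and "\<And>j. I j = {i j..<i (Suc j)}" and "\<And>j. I j \<noteq> {}"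
    and "disjoint_family I" and "(\<Union>j. I j) = UNIV"
    and "i 0 = 0"
    and "filterlim (\<lambda>j. i (Suc j) - i j) at_top sequentially"
  shows "\<exists>k :: nat \<Rightarrow> nat. characterizes (\<lambda>n. int (k n)) H \<and>
    (\<forall>j. real (card {n. 1 \<le> n \<and> k n \<in> I j}) / real (card (I j)) \<ge> \<epsilon> j)"
proof -
  define G where "G = circle_cis ` H"
  interpret unit_subgroup G
  proof
    fix z w assume "z \<in> G" "w \<in> G"
    then obtain \<alpha> \<beta> where "z = circle_cis \<alpha>" "w = circle_cis \<beta>" "\<alpha> \<in> H" "\<beta> \<in> H"
      by (auto simp: G_def)
    then show "norm z = 1" "z * w \<in> G" "inverse z \<in> G"
      using assms(1) unfolding G_def is_subgroup_def
      by (auto simp: norm_circle_cis simp flip: circle_cis_add circle_cis_minus)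
  next
    show "1 \<in> G"
      using assms(1) unfolding G_def is_subgroup_def by (metis circle_cis_0 imageI)
  qed
  have "countable G"
    using assms(2) by (simp add: G_def)
  have mono_i: "strict_mono i"
    using assms(6,7) by (auto simp: strict_mono_Suc_iff)
  obtain A where A: "infinite A"
    "\<And>z \<eta>. z \<in> G \<Longrightarrow> 0 < \<eta> \<Longrightarrow> finite {k \<in> A. \<eta> \<le> norm (z ^ k - 1)}"
    "\<And>z. norm z = 1 \<Longrightarrow> finite {k \<in> A. 1 < norm (z ^ k - 1)} \<Longrightarrow> z \<in> G"
    "\<And>j. \<epsilon> j * real (i (Suc j) - i j) \<le> card (A \<inter> {i j..<i (Suc j)})"
    using dense_characterizing_set[OF \<open>countable G\<close> assms(4,5,10) mono_i assms(11)] by blast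
  \<comment> \<open>Only the indices \<open>n \<ge> 1\<close> count for the density, so \<open>k 0\<close> is a dummy.\<close>
  define k where "k = (\<lambda>n. enumerate A (n - 1))"
  have bij: "bij_betw (enumerate A) UNIV A"
    using A(1) by (rule bij_enumerate)
  \<comment> \<open>Convergence means finitely many exceptional indices for each
    \<open>\<eta>\<close>, and the bijective enumeration carries these to exceptional elements of
    \<open>A\<close>.\<close>
  have tendsto_iff: "(\<lambda>n. z ^ k n) \<longlonglongrightarrow> 1 \<longleftrightarrow> (\<forall>\<eta>>0. finite {k \<in> A. \<eta> \<le> norm (z ^ k - 1)})"
    for z :: complex
  proof -
    have "(\<lambda>n. z ^ k n) \<longlonglongrightarrow> 1 \<longleftrightarrow> (\<lambda>n. z ^ enumerate A n) \<longlonglongrightarrow> 1"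
      using filterlim_sequentially_Suc[of "\<lambda>n. z ^ k n"] by (simp add: k_def)
    also have "\<dots> \<longleftrightarrow> (\<forall>\<eta>>0. finite {n. \<eta> \<le> norm (z ^ enumerate A n - 1)})"
      by (simp add: tendsto_iff dist_norm not_less flip: cofinite_eq_sequentially)
         (simp add: eventually_cofinite not_less)
    also have "\<dots> \<longleftrightarrow> (\<forall>\<eta>>0. finite {k \<in> A. \<eta> \<le> norm (z ^ k - 1)})"
    proof (intro all_cong bij_betw_finite)
      fix \<eta>
      show "bij_betw (enumerate A) {n. \<eta> \<le> norm (z ^ enumerate A n - 1)} {k \<in> A. \<eta> \<le> norm (z ^ k - 1)}"
        using bij by (auto simp: bij_betw_def inj_on_def)
    qed
    finally show ?thesis .
  qed
  have "characterizes (\<lambda>n. int (k n)) H"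
    unfolding characterizes_def
  proof
    fix \<alpha>
    have "\<alpha> \<in> H \<longleftrightarrow> circle_cis \<alpha> \<in> G"
      using inj_circle_cis by (simp add: G_def inj_image_mem_iff)
    also have "\<dots> \<longleftrightarrow> (\<lambda>n. circle_cis \<alpha> ^ k n) \<longlonglongrightarrow> 1"
    proof
      assume "(\<lambda>n. circle_cis \<alpha> ^ k n) \<longlonglongrightarrow> 1"
      then have "finite {k \<in> A. 1 \<le> norm (circle_cis \<alpha> ^ k - 1)}"
        by (simp add: tendsto_iff)
      then have "finite {k \<in> A. 1 < norm (circle_cis \<alpha> ^ k - 1)}"
        by (rule rev_finite_subset) auto
      then show "circle_cis \<alpha> \<in> G"
        by (rule A(3)[OF norm_circle_cis])
    qed (use A(2) tendsto_iff in blast)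
    finally show "\<alpha> \<in> H \<longleftrightarrow> (\<lambda>n. int_multiple (int (k n)) \<alpha>) \<longlonglongrightarrow> 0"
      by (simp add: tendsto_0_iff_circle_cis circle_cis_int_multiple)
  qed
  moreover have "\<epsilon> j \<le> real (card {n. 1 \<le> n \<and> k n \<in> I j}) / real (card (I j))" for j
  proof -
    \<comment> \<open>The shift by one cancels the \<open>n - 1\<close> in \<open>k\<close>, so the
      dummy index 0 is not counted.\<close>
    have "{n. 1 \<le> n \<and> k n \<in> I j} = Suc ` {n. enumerate A n \<in> I j}"
      by (auto simp: k_def image_iff Suc_le_eq gr0_conv_Suc)
    then have "card {n. 1 \<le> n \<and> k n \<in> I j} = card {n. enumerate A n \<in> I j}"
      by (simp add: card_image)
    also have "\<dots> = card (A \<inter> I j)"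
      by (rule bij_betw_same_card[of "enumerate A"]) (use bij in \<open>auto simp: bij_betw_def inj_on_def\<close>)
    finally show ?thesis
      using A(4)[of j] strict_monoD[OF mono_i, of j "Suc j"] by (simp add: assms(6) pos_le_divide_eq)
  qed
  ultimately show ?thesis
    by blast
qed

end
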